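(* Let $M$ be a metric space with distinguished point $0$, let $f_1,\dots,f_N\in \mathrm{Lip}_0(M,M)$ be a disjoint $\mathcal{A}$-transitive tuple on $M$, where $\mathcal{A}\subset\mathcal{P}(\mathbb{N})$ is a filter. Then the corresponding linear operators $T_{f_1},\dots,T_{f_N}$ are disjoint $\mathcal{A}$-transitive on the Lipschitz-free space $\mathcal{F}(M)$.
   Context: $\mathbb{N}=\{0,1,2,\dots\}$. $\mathrm{Lip}_0(M,M)$ is the set of Lipschitz maps $f\colon M\to M$ with $f(0)=0$. $\mathrm{Lip}_0(M)$ is the real Banach space of Lipschitz functions $M\to\mathbb{R}$ vanishing at $0$, normed by the best Lipschitz constant. For $x\in M$, $\delta_x\in \mathrm{Lip}_0(M)^*$ is evaluation at $x$. The Lipschitz-free space is $\mathcal{F}(M):=\overline{\mathrm{span}}\{\delta_x:x\in M\}\subset \mathrm{Lip}_0(M)^*$; one has $\|\delta_x-\delta_y\|=d(x,y)$. For $f\in\mathrm{Lip}_0(M,M)$, $T_f\colon\mathcal{F}(M)\to\mathcal{F}(M)$ is the unique bounded linear operator with $T_f(\delta_x)=\delta_{f(x)}$ for all $x\in M$. A family $\mathcal{A}\subset\mathcal{P}(\mathbb{N})$ is a Furstenberg family if every $A\in\mathcal{A}$ is infinite, and $A\in\mathcal{A}$, $A\subset B\subset\mathbb{N}$ imply $B\in\mathcal{A}$. It is a filter if moreover $A,B\in\mathcal{A}$ implies $A\cap B\in\mathcal{A}$. A tuple $h_1,\dots,h_N$ of continuous self-maps of a Hausdorff topological space $Y$ is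 disjoint $\mathcal{A}$-transitive if for all non-empty open sets $U_0,\dots,U_N\subset Y$, $$\{m\in\mathbb{N}: U_0\cap h_1^{-m}(U_1)\cap\dots\cap h_N^{-m}(U_N)\neq\emptyset\}\in\mathcal{A},$$ where $h_i^{-m}(\cdot)$ denotes preimage under the $m$-th iterate. *)

theory Defs
  imports "HOL-Analysis.Analysis"
begin

section \<open>Pointed metric spaces and Lipschitz maps\<close>

text \<open>
  A pointed metric space is a type of sort \<open>{metric_space, zero}\<close>. The class \<open>zero\<close> has no
  axioms, so \<open>0\<close> is an arbitrary distinguished point.
\<close>

definition Lip0 :: "('a::{metric_space,zero} \<Rightarrow> 'b::{metric_space,zero}) set" where
  "Lip0 = {f. f 0 = 0 \<and> (\<exists>L. L-lipschitz_on UNIV f)}"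

lemma Lip0I: "f 0 = 0 \<Longrightarrow> L-lipschitz_on UNIV f \<Longrightarrow> f \<in> Lip0"
  by (auto simp: Lip0_def)

typedef (overloaded) 'a lip0 = "Lip0 :: ('a::{metric_space,zero} \<Rightarrow> real) set"
  morphisms apply_lip0 Lip0_Abs
proof
  show "(\<lambda>_. 0) \<in> Lip0"
    by (rule Lip0I[of _ 0]) (auto simp: lipschitz_on_def)
qed

setup_lifting type_definition_lip0

lemma lip0_eqI: "(\<And>x. apply_lip0 f x = apply_lip0 g x) \<Longrightarrow> f = g"
  by transfer auto

instantiation lip0 :: ("{metric_space,zero}") real_vector
begin

lift_definition zero_lip0 :: "'a lip0" is "\<lambda>_. 0"
  by (rule Lip0I[of _ 0]) (auto simp: lipschitz_on_def)

lift_definition uminus_lip0 :: "'a lip0 \<Rightarrow> 'a lip0" is "\<lambda>f x. - f x"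
  by (auto simp: Lip0_def)

lift_definition plus_lip0 :: "'a lip0 \<Rightarrow> 'a lip0 \<Rightarrow> 'a lip0" is "\<lambda>f g x. f x + g x"
  by (auto simp: Lip0_def intro: lipschitz_on_add)

lift_definition minus_lip0 :: "'a lip0 \<Rightarrow> 'a lip0 \<Rightarrow> 'a lip0" is "\<lambda>f g x. f x - g x"
  by (auto simp: Lip0_def intro: lipschitz_on_diff)

lift_definition scaleR_lip0 :: "real \<Rightarrow> 'a lip0 \<Rightarrow> 'a lip0" is "\<lambda>r f x. r * f x"
  by (auto simp: Lip0_def intro: lipschitz_on_cmult_real)

instance
  by standard (transfer; simp add: algebra_simps)+

end

lemmas apply_lip0_simps [simp] =
  zero_lip0.rep_eq uminus_lip0.rep_eq plus_lip0.rep_eq minus_lip0.rep_eq scaleR_lip0.rep_eq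

lemma Inf_lipschitz:
  assumes "L-lipschitz_on UNIV f"
  shows "(Inf {L. L-lipschitz_on UNIV f})-lipschitz_on UNIV f"
proof -
  let ?S = "{L. L-lipschitz_on UNIV f}"
  have ne: "?S \<noteq> {}" using assms by auto
  have "dist (f x) (f y) \<le> Inf ?S * dist x y" for x y
  proof (cases "x = y")
    case False
    then have "dist (f x) (f y) / dist x y \<le> Inf ?S"
      by (intro cInf_greatest[OF ne]) (auto simp: lipschitz_on_def field_simps)
    with False show ?thesis by (simp add: field_simps)
  qed simp
  moreover have "0 \<le> Inf ?S"
    by (rule cInf_greatest[OF ne]) (auto simp: lipschitz_on_def)
  ultimately show ?thesis by (auto simp: lipschitz_on_def)
qed

lemma Inf_lipschitz_le:
  "L-lipschitz_on UNIV f \<Longrightarrow> Inf {L. L-lipschitz_on UNIV f} \<le> L"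
  by (rule cInf_lower) (auto simp: bdd_below_def lipschitz_on_def)

instantiation lip0 :: ("{metric_space,zero}") real_normed_vector
begin

definition norm_lip0 :: "'a lip0 \<Rightarrow> real" where
  "norm_lip0 f = Inf {L. L-lipschitz_on UNIV (apply_lip0 f)}"

definition dist_lip0 :: "'a lip0 \<Rightarrow> 'a lip0 \<Rightarrow> real" where
  "dist_lip0 f g = norm (f - g)"

definition sgn_lip0 :: "'a lip0 \<Rightarrow> 'a lip0" where
  "sgn_lip0 f = f /\<^sub>R norm f"

definition uniformity_lip0 :: "('a lip0 \<times> 'a lip0) filter" where
  "uniformity_lip0 = (INF e\<in>{0 <..}. principal {(x, y). dist x y < e})"

definition open_lip0 :: "'a lip0 set \<Rightarrow> bool" where
  "open_lip0 S = (\<forall>x\<in>S. \<forall>\<^sub>F (x', y) in uniformity. x' = x \<longrightarrow> y \<in> S)"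

lemma lipschitz_norm_lip0: "(norm f)-lipschitz_on UNIV (apply_lip0 f)"
  using apply_lip0[of f] Inf_lipschitz by (auto simp: norm_lip0_def Lip0_def)

lemma norm_lip0_le: "L-lipschitz_on UNIV (apply_lip0 f) \<Longrightarrow> norm f \<le> L"
  unfolding norm_lip0_def by (rule Inf_lipschitz_le)

instance
proof
  fix f g :: "'a lip0" and r :: real
  show "norm f = 0 \<longleftrightarrow> f = 0"
  proof
    assume "norm f = 0"
    then have "dist (apply_lip0 f x) (apply_lip0 f 0) \<le> 0" for x
      using lipschitz_onD[OF lipschitz_norm_lip0[of f], of x 0] by simp
    moreover have "apply_lip0 f 0 = 0" using apply_lip0[of f] by (simp add: Lip0_def)
    ultimately show "f = 0" by (intro lip0_eqI) simp
  next
    assume f: "f = 0"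
    have "norm f \<le> 0"
      by (rule norm_lip0_le) (simp add: f lipschitz_on_def)
    moreover have "0 \<le> norm f" by (rule lipschitz_on_nonneg[OF lipschitz_norm_lip0])
    ultimately show "norm f = 0" by simp
  qed
  show "norm (f + g) \<le> norm f + norm g"
  proof (rule norm_lip0_le)
    show "(norm f + norm g)-lipschitz_on UNIV (apply_lip0 (f + g))"
      using lipschitz_on_add[OF lipschitz_norm_lip0[of f] lipschitz_norm_lip0[of g]] by simp
  qed
  have le: "norm (r *\<^sub>R f) \<le> \<bar>r\<bar> * norm f" for r and f :: "'a lip0"
  proof (rule norm_lip0_le)
    show "(\<bar>r\<bar> * norm f)-lipschitz_on UNIV (apply_lip0 (r *\<^sub>R f))"
      using lipschitz_on_cmult_real[OF lipschitz_norm_lip0[of f], of r] by simp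
  qed
  show "norm (r *\<^sub>R f) = \<bar>r\<bar> * norm f"
  proof (cases "r = 0")
    case True
    have "norm (r *\<^sub>R f) \<ge> 0" by (rule lipschitz_on_nonneg[OF lipschitz_norm_lip0])
    with True le[of r f] show ?thesis by auto
  next
    case False
    then have "norm f = norm ((1 / r) *\<^sub>R (r *\<^sub>R f))" by simp
    also have "\<dots> \<le> \<bar>1 / r\<bar> * norm (r *\<^sub>R f)" by (rule le)
    finally have "\<bar>r\<bar> * norm f \<le> norm (r *\<^sub>R f)"
      using False by (simp add: field_simps)
    with le[of r f] show ?thesis by simp
  qed
qed (simp_all add: dist_lip0_def sgn_lip0_def uniformity_lip0_def open_lip0_def)

end


section \<open>The Lipschitz-free space\<close>

lift_definition eval_lip0 :: "'a::{metric_space,zero} \<Rightarrow> 'a lip0 \<Rightarrow>\<^sub>L real"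
  is "\<lambda>x g. apply_lip0 g x"
proof -
  fix x :: 'a
  show "bounded_linear (\<lambda>g. apply_lip0 g x)"
  proof (rule bounded_linear_intro[where K = "dist x 0"])
    fix g :: "'a lip0"
    have "apply_lip0 g 0 = 0" using apply_lip0[of g] by (simp add: Lip0_def)
    then show "norm (apply_lip0 g x) \<le> norm g * dist x 0"
      using lipschitz_onD[OF lipschitz_norm_lip0[of g], of x 0] by simp
  qed simp_all
qed

typedef (overloaded) 'a lipfree =
  "closure (span (range eval_lip0)) :: ('a::{metric_space,zero} lip0 \<Rightarrow>\<^sub>L real) set"
  morphisms of_lipfree Abs_lipfree
proof
  show "0 \<in> closure (span (range eval_lip0))"
    by (rule subsetD[OF closure_subset span_zero])
qed

setup_lifting type_definition_lipfree

lemma subspace_lipfree: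
  "subspace (closure (span (range eval_lip0)) :: ('a::{metric_space,zero} lip0 \<Rightarrow>\<^sub>L real) set)"
proof -
  let ?S = "span (range eval_lip0) :: ('a::{metric_space,zero} lip0 \<Rightarrow>\<^sub>L real) set"
  have "x + y \<in> closure ?S" if xy: "x \<in> closure ?S" "y \<in> closure ?S" for x y
  proof -
    obtain a b where "\<And>n. a n \<in> ?S" "a \<longlonglongrightarrow> x" "\<And>n. b n \<in> ?S" "b \<longlonglongrightarrow> y"
      using xy unfolding closure_sequential by metis
    then show ?thesis
      unfolding closure_sequential
      by (intro exI[of _ "\<lambda>n. a n + b n"]) (simp add: span_add tendsto_add)
  qed
  moreover have "c *\<^sub>R x \<in> closure ?S" if x: "x \<in> closure ?S" for c x
  proof -
    obtain a where "\<And>n. a n \<in> ?S" "a \<longlonglongrightarrow> x"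
      using x unfolding closure_sequential by metis
    then show ?thesis
      unfolding closure_sequential
      by (intro exI[of _ "\<lambda>n. c *\<^sub>R a n"]) (simp add: span_scale tendsto_scaleR)
  qed
  moreover have "0 \<in> closure ?S"
    using closure_subset[of ?S] span_zero by (rule subsetD)
  ultimately show ?thesis by (simp add: subspace_def)
qed

instantiation lipfree :: ("{metric_space,zero}") real_vector
begin

lift_definition zero_lipfree :: "'a lipfree" is 0
  by (rule subspace_0[OF subspace_lipfree])

lift_definition uminus_lipfree :: "'a lipfree \<Rightarrow> 'a lipfree" is uminus
  by (rule subspace_neg[OF subspace_lipfree])

lift_definition plus_lipfree :: "'a lipfree \<Rightarrow> 'a lipfree \<Rightarrow> 'a lipfree" is "(+)"
  by (rule subspace_add[OF subspace_lipfree])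

lift_definition minus_lipfree :: "'a lipfree \<Rightarrow> 'a lipfree \<Rightarrow> 'a lipfree" is "(-)"
  by (rule subspace_diff[OF subspace_lipfree])

lift_definition scaleR_lipfree :: "real \<Rightarrow> 'a lipfree \<Rightarrow> 'a lipfree" is scaleR
  by (rule subspace_scale[OF subspace_lipfree])

instance
  by standard (transfer; simp add: algebra_simps)+

end

instantiation lipfree :: ("{metric_space,zero}") real_normed_vector
begin

lift_definition norm_lipfree :: "'a lipfree \<Rightarrow> real" is norm .

lift_definition dist_lipfree :: "'a lipfree \<Rightarrow> 'a lipfree \<Rightarrow> real" is dist .

definition sgn_lipfree :: "'a lipfree \<Rightarrow> 'a lipfree" where
  "sgn_lipfree u = u /\<^sub>R norm u"

definition uniformity_lipfree :: "('a lipfree \<times> 'a lipfree) filter" where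
  "uniformity_lipfree = (INF e\<in>{0 <..}. principal {(x, y). dist x y < e})"

definition open_lipfree :: "'a lipfree set \<Rightarrow> bool" where
  "open_lipfree S = (\<forall>x\<in>S. \<forall>\<^sub>F (x', y) in uniformity. x' = x \<longrightarrow> y \<in> S)"

instance
proof
  fix u v :: "'a lipfree" and r :: real
  show "dist u v = norm (u - v)" by transfer (rule dist_norm)
  show "norm u = 0 \<longleftrightarrow> u = 0" by transfer simp
  show "norm (u + v) \<le> norm u + norm v" by transfer (rule norm_triangle_ineq)
  show "norm (r *\<^sub>R u) = \<bar>r\<bar> * norm u" by transfer simp
qed (simp_all add: sgn_lipfree_def uniformity_lipfree_def open_lipfree_def)

end

lift_definition dirac :: "'a::{metric_space,zero} \<Rightarrow> 'a lipfree" is eval_lip0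
  by (rule subsetD[OF closure_subset span_base]) (rule rangeI)

definition lipfree_op ::
    "('a::{metric_space,zero} \<Rightarrow> 'a) \<Rightarrow> 'a lipfree \<Rightarrow>\<^sub>L 'a lipfree" where
  "lipfree_op f = (THE T. \<forall>x. blinfun_apply T (dirac x) = dirac (f x))"

text \<open>The description is proper for every \<open>f \<in> Lip0\<close>.\<close>

lemma lipfree_op_unique:
  fixes S T :: "'a::{metric_space,zero} lipfree \<Rightarrow>\<^sub>L 'b::real_normed_vector"
  assumes eq: "\<And>x. blinfun_apply S (dirac x) = blinfun_apply T (dirac x)"
  shows "S = T"
proof (rule blinfun_eqI)
  fix u :: "'a lipfree"
  define D where "D = S - T"
  have D0: "blinfun_apply D (dirac x) = 0" for x
    by (simp add: D_def eq blinfun.diff_left)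
  have spn: "\<exists>v. of_lipfree v = w \<and> blinfun_apply D v = 0"
    if "w \<in> span (range eval_lip0)" for w
    using that
  proof (induction rule: span_induct_alt)
    case base
    show ?case by (rule exI[of _ 0]) (simp add: zero_lipfree.rep_eq blinfun.zero_right)
  next
    case (step c x y)
    then obtain v a where v: "of_lipfree v = y" "blinfun_apply D v = 0" and a: "x = eval_lip0 a"
      by auto
    show ?case
      by (rule exI[of _ "c *\<^sub>R dirac a + v"])
        (simp add: v a D0 plus_lipfree.rep_eq scaleR_lipfree.rep_eq dirac.rep_eq
          blinfun.add_right blinfun.scaleR_right)
  qed
  have "u \<in> closure {v. blinfun_apply D v = 0}"
  proof (unfold closure_approachable, intro allI impI)
    fix e :: real assume "0 < e"
    then obtain w where w: "w \<in> span (range eval_lip0)" "dist w (of_lipfree u) < e"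
      using of_lipfree[of u] by (auto simp: closure_approachable)
    then show "\<exists>v\<in>{v. blinfun_apply D v = 0}. dist v u < e"
      using spn[OF w(1)] by (auto simp: dist_lipfree.rep_eq)
  qed
  moreover have "closed {v. blinfun_apply D v = 0}"
    by (intro closed_Collect_eq continuous_intros)
  ultimately have "blinfun_apply D u = 0" by simp
  then show "blinfun_apply S u = blinfun_apply T u"
    by (simp add: D_def blinfun.diff_left)
qed

lemma lipfree_op_exists:
  fixes f :: "'a::{metric_space,zero} \<Rightarrow> 'a"
  assumes "f \<in> Lip0"
  shows "\<exists>T :: 'a lipfree \<Rightarrow>\<^sub>L 'a lipfree. \<forall>x. blinfun_apply T (dirac x) = dirac (f x)"
proof -
  obtain L where f0: "f 0 = 0" and L: "L-lipschitz_on UNIV f"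
    using assms by (auto simp: Lip0_def)
  define C where "C g = Lip0_Abs (apply_lip0 g \<circ> f)" for g :: "'a lip0"
  have lip: "(norm g * L)-lipschitz_on UNIV (apply_lip0 g \<circ> f)" for g :: "'a lip0"
    using lipschitz_on_compose[OF L lipschitz_on_subset[OF lipschitz_norm_lip0[of g]]] by simp
  have mem: "apply_lip0 g \<circ> f \<in> Lip0" for g :: "'a lip0"
    using apply_lip0[of g] by (intro Lip0I[OF _ lip]) (simp add: Lip0_def f0)
  have C: "apply_lip0 (C g) x = apply_lip0 g (f x)" for g x
    unfolding C_def by (simp add: Lip0_Abs_inverse[OF mem])
  have "bounded_linear C"
  proof (rule bounded_linear_intro[where K = L])
    fix g :: "'a lip0"
    show "norm (C g) \<le> norm g * L"
      by (rule norm_lip0_le) (use lip[of g] in \<open>simp add: C_def Lip0_Abs_inverse[OF mem]\<close>)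
  qed (auto intro!: lip0_eqI simp: C)
  then have CB: "blinfun_apply (Blinfun C) = C" by (rule bounded_linear_Blinfun_apply)
  define A where "A \<phi> = \<phi> o\<^sub>L Blinfun C" for \<phi> :: "'a lip0 \<Rightarrow>\<^sub>L real"
  have A: "bounded_linear A"
    unfolding A_def by (rule bounded_bilinear.bounded_linear_left[OF bounded_bilinear_blinfun_compose])
  have Aev: "A (eval_lip0 x) = eval_lip0 (f x)" for x
    by (rule blinfun_eqI) (simp add: A_def CB eval_lip0.rep_eq C)
  have "A ` closure (span (range eval_lip0)) \<subseteq> closure (A ` span (range eval_lip0))"
    by (rule closure_bounded_linear_image_subset[OF A])
  also have "A ` span (range eval_lip0) = span (A ` range eval_lip0)"
    by (rule linear_span_image[symmetric]) (rule bounded_linear.linear[OF A])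
  also have "closure \<dots> \<subseteq> closure (span (range eval_lip0))"
    by (intro closure_mono span_mono) (auto simp: Aev)
  finally have A_in: "A (of_lipfree u) \<in> closure (span (range eval_lip0))" for u
    using of_lipfree[of u] by blast
  define T where "T u = Abs_lipfree (A (of_lipfree u))" for u
  have T: "of_lipfree (T u) = A (of_lipfree u)" for u
    unfolding T_def by (rule Abs_lipfree_inverse[OF A_in])
  obtain K where K: "\<And>\<phi>. norm (A \<phi>) \<le> norm \<phi> * K"
    using bounded_linear.bounded[OF A] by blast
  have "bounded_linear T"
  proof (rule bounded_linear_intro[where K = K])
    show "norm (T u) \<le> norm u * K" for u
      by (simp add: norm_lipfree.rep_eq T K)
  qed (simp_all add: of_lipfree_inject[symmetric] T plus_lipfree.rep_eq scaleR_lipfree.rep_eq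
      bounded_linear.linear[OF A] linear_add linear_scale)
  then have "blinfun_apply (Blinfun T) (dirac x) = dirac (f x)" for x
    by (simp add: bounded_linear_Blinfun_apply of_lipfree_inject[symmetric] T dirac.rep_eq Aev)
  then show ?thesis by blast
qed

lemma lipfree_op_dirac:
  assumes "f \<in> Lip0"
  shows "blinfun_apply (lipfree_op f) (dirac x) = dirac (f x)"
proof -
  have "\<exists>!T. \<forall>x. blinfun_apply T (dirac x) = dirac (f x)"
    using lipfree_op_exists[OF assms] by (auto intro!: lipfree_op_unique)
  from theI'[OF this] show ?thesis by (simp add: lipfree_op_def)
qed


section \<open>Furstenberg families and disjoint transitivity\<close>

definition furstenberg_family :: "nat set set \<Rightarrow> bool" where
  "furstenberg_family \<A> \<longleftrightarrow>
    (\<forall>A\<in>\<A>. infinite A) \<and> (\<forall>A B. A \<in> \<A> \<longrightarrow> A \<subseteq> B \<longrightarrow> B \<in> \<A>)"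

definition furstenberg_filter :: "nat set set \<Rightarrow> bool" where
  "furstenberg_filter \<A> \<longleftrightarrow>
    furstenberg_family \<A> \<and> (\<forall>A B. A \<in> \<A> \<longrightarrow> B \<in> \<A> \<longrightarrow> A \<inter> B \<in> \<A>)"

text \<open>The tuple consists of \<open>h 1, \<dots>, h N\<close>; the other values of \<open>h\<close> are irrelevant.\<close>

definition disjoint_transitive ::
    "nat set set \<Rightarrow> nat \<Rightarrow> (nat \<Rightarrow> 'y::t2_space \<Rightarrow> 'y) \<Rightarrow> bool" where
  "disjoint_transitive \<A> N h \<longleftrightarrow>
    (\<forall>i\<in>{1..N}. continuous_on UNIV (h i)) \<and>
    (\<forall>U. (\<forall>i\<in>{0..N}. open (U i) \<and> U i \<noteq> {}) \<longrightarrow>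
      {m. U 0 \<inter> (\<Inter>i\<in>{1..N}. (h i ^^ m) -` U i) \<noteq> {}} \<in> \<A>)"

end

(* Call a tuple (u_0, ..., u_N) approximable if for every e > 0 the set of all m, for which some
   v is e-close to u_0 while each T_i^m v is e-close to u_i, belongs to the filter. The filter
   property and linearity make the approximable tuples a closed linear subspace, and disjoint
   transitivity of f puts every tuple of Dirac elements into it. Since dirac 0 = 0, this includes
   the tuples with a single Dirac entry and zeros elsewhere; their closed span is everything. *)
theory Submission
  imports Defs
begin

text \<open>The span of the evaluations lives in the dual of \<open>lip0\<close>, while
  \<open>dirac\<close> takes values in the separate type \<open>lipfree\<close>. Since
  \<open>of_lipfree\<close> is linear and sends \<open>dirac a\<close> to
  \<open>eval_lip0 a\<close>, a preimage can be built along the span induction.\<close>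

lemma of_lipfree_span_dirac:
  assumes "w \<in> span (range eval_lip0)"
  shows "\<exists>v\<in>span (range dirac). of_lipfree v = w"
  using assms
proof (induction rule: span_induct_alt)
  case base
  show ?case by (rule bexI[of _ 0]) (simp_all add: zero_lipfree.rep_eq span_zero)
next
  case (step c x y)
  then obtain v a where v: "v \<in> span (range dirac)" "of_lipfree v = y" and a: "x = eval_lip0 a"
    by auto
  have "c *\<^sub>R dirac a + v \<in> span (range dirac)"
    by (intro span_add span_scale v) (simp add: span_base)
  then show ?case
    by (rule rev_bexI) (simp add: v a plus_lipfree.rep_eq scaleR_lipfree.rep_eq dirac.rep_eq)
qed

text \<open>Distances in \<open>lipfree\<close> are those of the dual space, so an approximant from
  the span of the evaluations lifts to one from the span of the Dirac elements.\<close>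

lemma closure_span_dirac: "closure (span (range dirac)) = UNIV"
proof -
  have "u \<in> closure (span (range dirac))" for u :: "'a lipfree"
    unfolding closure_approachable
  proof (intro allI impI)
    fix e :: real assume "0 < e"
    then obtain w where "w \<in> span (range eval_lip0)" "dist w (of_lipfree u) < e"
      using of_lipfree[of u] by (auto simp: closure_approachable)
    then show "\<exists>v\<in>span (range dirac). dist v u < e"
      using of_lipfree_span_dirac by (force simp: dist_lipfree.rep_eq)
  qed
  then show ?thesis by blast
qed

text \<open>Every function in \<open>lip0\<close> vanishes at the base point. This is what lets a
  zero vector count as a Dirac element later on.\<close>

lemma dirac_0 [simp]: "dirac 0 = 0"
proof -
  have "eval_lip0 0 = (0 :: 'a lip0 \<Rightarrow>\<^sub>L real)"
    by (rule blinfun_eqI) (use apply_lip0 in \<open>auto simp: eval_lip0.rep_eq Lip0_def\<close>)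
  then show ?thesis
    by (simp add: of_lipfree_inject[symmetric] dirac.rep_eq zero_lipfree.rep_eq)
qed

text \<open>Bounds the operator norm of the difference of two evaluations: each \<open>g\<close> is
  Lipschitz with constant \<open>norm g\<close>.\<close>

lemma dist_dirac_le: "dist (dirac x) (dirac y) \<le> dist x y"
  unfolding dist_lipfree.rep_eq dirac.rep_eq dist_norm
proof (rule norm_blinfun_bound)
  show "norm (blinfun_apply (eval_lip0 x - eval_lip0 y) g) \<le> dist x y * norm g" for g :: "'a lip0"
    using lipschitz_onD[OF lipschitz_norm_lip0[of g], of x y]
    by (simp add: blinfun.diff_left eval_lip0.rep_eq dist_real_def mult.commute)
qed simp

lemma lipfree_op_funpow_dirac:
  assumes "f \<in> Lip0"
  shows "(blinfun_apply (lipfree_op f) ^^ m) (dirac x) = dirac ((f ^^ m) x)"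
  by (induction m) (simp_all add: lipfree_op_dirac[OF assms])

lemma linear_funpow:
  fixes f :: "'b::real_vector \<Rightarrow> 'b"
  assumes "linear f"
  shows "linear (f ^^ m)"
proof (induction m)
  case 0
  show ?case by (simp add: linear_id flip: id_def)
next
  case (Suc m)
  show ?case using linear_compose[OF Suc.IH assms] by (simp only: funpow.simps)
qed

definition approximable ::
    "nat set set \<Rightarrow> nat \<Rightarrow> (nat \<Rightarrow> 'b::real_normed_vector \<Rightarrow> 'b) \<Rightarrow> (nat \<Rightarrow> 'b) \<Rightarrow> bool" where
  "approximable \<A> N T u \<longleftrightarrow>
    (\<forall>e>0. {m. \<exists>v. dist v (u 0) < e \<and> (\<forall>i\<in>{1..N}. dist ((T i ^^ m) v) (u i) < e)} \<in> \<A>)"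

lemma approximableD:
  assumes "approximable \<A> N T u" and "e > 0"
  shows "{m. \<exists>v. dist v (u 0) < e \<and> (\<forall>i\<in>{1..N}. dist ((T i ^^ m) v) (u i) < e)} \<in> \<A>"
  using assms by (simp add: approximable_def)

text \<open>Adding a witness for \<open>u\<close> to one for \<open>u'\<close> requires both to
  exist for the same \<open>m\<close>. This is where closure of the filter under intersections
  enters.\<close>

lemma approximable_add:
  assumes "furstenberg_filter \<A>" and lin: "\<And>i. i \<in> {1..N} \<Longrightarrow> linear (T i)"
    and u: "approximable \<A> N T u" and u': "approximable \<A> N T u'"
  shows "approximable \<A> N T (\<lambda>i. u i + u' i)"
  unfolding approximable_def
proof (intro allI impI)
  fix e :: real assume "e > 0"
  define S where "S u e = {m. \<exists>v. dist v (u 0) < e \<and> (\<forall>i\<in>{1..N}. dist ((T i ^^ m) v) (u i) < e)}"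
    for u and e :: real
  have "S u (e/2) \<inter> S u' (e/2) \<subseteq> S (\<lambda>i. u i + u' i) e"
  proof
    fix m assume "m \<in> S u (e/2) \<inter> S u' (e/2)"
    then obtain v v' where v: "dist v (u 0) < e/2" "\<And>i. i \<in> {1..N} \<Longrightarrow> dist ((T i ^^ m) v) (u i) < e/2"
      and v': "dist v' (u' 0) < e/2" "\<And>i. i \<in> {1..N} \<Longrightarrow> dist ((T i ^^ m) v') (u' i) < e/2"
      unfolding S_def by blast
    have "dist ((T i ^^ m) (v + v')) (u i + u' i) < e" if "i \<in> {1..N}" for i
      using dist_triangle_add[of "(T i ^^ m) v" "(T i ^^ m) v'" "u i" "u' i"] v(2)[OF that] v'(2)[OF that]
        linear_add[OF linear_funpow[OF lin[OF that]], of m v v'] by simp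
    then show "m \<in> S (\<lambda>i. u i + u' i) e"
      unfolding S_def using dist_triangle_add[of v v' "u 0" "u' 0"] v(1) v'(1)
      by (intro CollectI exI[of _ "v + v'"]) auto
  qed
  moreover have "S u (e/2) \<in> \<A>" "S u' (e/2) \<in> \<A>"
    unfolding S_def
    by (rule approximableD[OF u half_gt_zero[OF \<open>e > 0\<close>]] approximableD[OF u' half_gt_zero[OF \<open>e > 0\<close>]])+
  ultimately have "S (\<lambda>i. u i + u' i) e \<in> \<A>"
    using assms(1) unfolding furstenberg_filter_def furstenberg_family_def by blast
  then show "{m. \<exists>v. dist v (u 0 + u' 0) < e \<and>
      (\<forall>i\<in>{1..N}. dist ((T i ^^ m) v) (u i + u' i) < e)} \<in> \<A>"
    by (simp add: S_def)
qed

text \<open>The iterates are linear, so \<open>c *\<^sub>R v\<close> serves the scaled tuple at the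
  same \<open>m\<close> at which \<open>v\<close> serves \<open>u\<close>.\<close>

lemma approximable_scaleR:
  fixes T :: "nat \<Rightarrow> 'b::real_normed_vector \<Rightarrow> 'b"
  assumes "furstenberg_family \<A>" and lin: "\<And>i. i \<in> {1..N} \<Longrightarrow> linear (T i)"
    and u: "approximable \<A> N T u"
  shows "approximable \<A> N T (\<lambda>i. c *\<^sub>R u i)"
  unfolding approximable_def
proof (intro allI impI)
  fix e :: real assume "e > 0"
  \<comment> \<open>The summand 1 covers \<open>c = 0\<close> and makes the bound by
    \<open>e\<close> in \<open>small\<close> strict.\<close>
  define d where "d = e / (\<bar>c\<bar> + 1)"
  have d: "d > 0" using \<open>e > 0\<close> by (simp add: d_def)
  have small: "dist (c *\<^sub>R x) (c *\<^sub>R y) < e" if "dist x y < d" for x y :: 'b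
  proof -
    have "\<bar>c\<bar> * dist x y \<le> \<bar>c\<bar> * d" using that by (intro mult_left_mono) auto
    also have "\<dots> < (\<bar>c\<bar> + 1) * d" using d by (simp add: algebra_simps)
    also have "\<dots> = e" by (simp add: d_def)
    finally show ?thesis by (simp add: dist_norm flip: scaleR_diff_right)
  qed
  have "{m. \<exists>v. dist v (u 0) < d \<and> (\<forall>i\<in>{1..N}. dist ((T i ^^ m) v) (u i) < d)}
      \<subseteq> {m. \<exists>v. dist v (c *\<^sub>R u 0) < e \<and> (\<forall>i\<in>{1..N}. dist ((T i ^^ m) v) (c *\<^sub>R u i) < e)}"
  proof clarify
    fix m v assume v: "dist v (u 0) < d" "\<forall>i\<in>{1..N}. dist ((T i ^^ m) v) (u i) < d"
    have "dist ((T i ^^ m) (c *\<^sub>R v)) (c *\<^sub>R u i) < e" if "i \<in> {1..N}" for i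
      unfolding linear_scale[OF linear_funpow[OF lin[OF that]]] using v(2) that by (intro small) auto
    then show "\<exists>v. dist v (c *\<^sub>R u 0) < e \<and> (\<forall>i\<in>{1..N}. dist ((T i ^^ m) v) (c *\<^sub>R u i) < e)"
      using small[OF v(1)] by (intro exI[of _ "c *\<^sub>R v"]) auto
  qed
  moreover have "{m. \<exists>v. dist v (u 0) < d \<and> (\<forall>i\<in>{1..N}. dist ((T i ^^ m) v) (u i) < d)} \<in> \<A>"
    by (rule approximableD[OF u d])
  ultimately show "{m. \<exists>v. dist v (c *\<^sub>R u 0) < e \<and>
      (\<forall>i\<in>{1..N}. dist ((T i ^^ m) v) (c *\<^sub>R u i) < e)} \<in> \<A>"
    using assms(1) unfolding furstenberg_family_def by blast
qed

text \<open>A witness within \<open>e/2\<close> of a tuple \<open>u'\<close> that is itself within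
  \<open>e/2\<close> of \<open>u\<close> is a witness for \<open>u\<close> at the same
  \<open>m\<close>, so upward closure of the family suffices.\<close>

lemma approximable_closed:
  assumes "furstenberg_family \<A>"
    and approx: "\<And>e. e > 0 \<Longrightarrow> \<exists>u'. approximable \<A> N T u' \<and> (\<forall>i\<in>{0..N}. dist (u' i) (u i) < e)"
  shows "approximable \<A> N T u"
  unfolding approximable_def
proof (intro allI impI)
  fix e :: real assume "e > 0"
  then obtain u' where u': "approximable \<A> N T u'" "\<And>i. i \<in> {0..N} \<Longrightarrow> dist (u' i) (u i) < e/2"
    using approx[of "e/2"] by auto
  have "{m. \<exists>v. dist v (u' 0) < e/2 \<and> (\<forall>i\<in>{1..N}. dist ((T i ^^ m) v) (u' i) < e/2)}
      \<subseteq> {m. \<exists>v. dist v (u 0) < e \<and> (\<forall>i\<in>{1..N}. dist ((T i ^^ m) v) (u i) < e)}"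
  proof clarify
    fix m v assume v: "dist v (u' 0) < e/2" "\<forall>i\<in>{1..N}. dist ((T i ^^ m) v) (u' i) < e/2"
    have "dist ((T i ^^ m) v) (u i) < e" if "i \<in> {1..N}" for i
      using dist_triangle_half_r[of "u' i" "(T i ^^ m) v" e "u i"] v(2) u'(2)[of i] that
      by (simp add: dist_commute)
    moreover have "dist v (u 0) < e"
      using dist_triangle_half_r[of "u' 0" v e "u 0"] v(1) u'(2)[of 0] by (simp add: dist_commute)
    ultimately show "\<exists>v. dist v (u 0) < e \<and> (\<forall>i\<in>{1..N}. dist ((T i ^^ m) v) (u i) < e)"
      by blast
  qed
  moreover have "{m. \<exists>v. dist v (u' 0) < e/2 \<and> (\<forall>i\<in>{1..N}. dist ((T i ^^ m) v) (u' i) < e/2)} \<in> \<A>"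
    by (rule approximableD[OF u'(1) half_gt_zero[OF \<open>e > 0\<close>]])
  ultimately show "{m. \<exists>v. dist v (u 0) < e \<and> (\<forall>i\<in>{1..N}. dist ((T i ^^ m) v) (u i) < e)} \<in> \<A>"
    using assms(1) unfolding furstenberg_family_def by blast
qed

text \<open>Finitely many non-empty open sets contain balls of one common radius \<open>d\<close>,
  and a witness for the centres at precision \<open>d\<close> lies in the required
  intersection.\<close>

lemma disjoint_transitive_if_approximable:
  fixes T :: "nat \<Rightarrow> 'b::real_normed_vector \<Rightarrow> 'b"
  assumes "furstenberg_family \<A>" and "\<And>i. i \<in> {1..N} \<Longrightarrow> continuous_on UNIV (T i)"
    and approx: "\<And>u. approximable \<A> N T u"
  shows "disjoint_transitive \<A> N T"
  unfolding disjoint_transitive_def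
proof (intro conjI allI impI ballI)
  fix U :: "nat \<Rightarrow> 'b set"
  assume "\<forall>i\<in>{0..N}. open (U i) \<and> U i \<noteq> {}"
  then have "\<forall>i\<in>{0..N}. \<exists>x e. e > 0 \<and> ball x e \<subseteq> U i"
    by (metis ex_in_conv open_contains_ball)
  then obtain u e where e: "\<And>i. i \<in> {0..N} \<Longrightarrow> e i > 0" "\<And>i. i \<in> {0..N} \<Longrightarrow> ball (u i) (e i) \<subseteq> U i"
    by metis
  define d where "d = Min (e ` {0..N})"
  have "d > 0" using e(1) by (simp add: d_def)
  have U: "x \<in> U i" if "i \<in> {0..N}" "dist x (u i) < d" for i x
  proof -
    have "d \<le> e i" using that(1) by (simp add: d_def)
    then have "x \<in> ball (u i) (e i)" using that(2) by (simp add: dist_commute)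
    then show ?thesis using e(2)[OF that(1)] by blast
  qed
  have "{m. \<exists>v. dist v (u 0) < d \<and> (\<forall>i\<in>{1..N}. dist ((T i ^^ m) v) (u i) < d)}
      \<subseteq> {m. U 0 \<inter> (\<Inter>i\<in>{1..N}. (T i ^^ m) -` U i) \<noteq> {}}"
  proof clarify
    fix m v assume v: "dist v (u 0) < d" "\<forall>i\<in>{1..N}. dist ((T i ^^ m) v) (u i) < d"
      and empty: "U 0 \<inter> (\<Inter>i\<in>{1..N}. (T i ^^ m) -` U i) = {}"
    have "v \<in> U 0" using U v(1) by simp
    moreover have "(T i ^^ m) v \<in> U i" if "i \<in> {1..N}" for i
      using U[of i] v(2) that by simp
    ultimately show False using empty by blast
  qed
  moreover have "{m. \<exists>v. dist v (u 0) < d \<and> (\<forall>i\<in>{1..N}. dist ((T i ^^ m) v) (u i) < d)} \<in> \<A>"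
    by (rule approximableD[OF approx \<open>d > 0\<close>])
  ultimately show "{m. U 0 \<inter> (\<Inter>i\<in>{1..N}. (T i ^^ m) -` U i) \<noteq> {}} \<in> \<A>"
    using assms(1) unfolding furstenberg_family_def by blast
qed (use assms(2) in auto)

text \<open>A point \<open>y\<close> of the metric space whose orbits hit the balls around the
  \<open>x i\<close> yields the witness \<open>dirac y\<close>: the operators move Dirac elements as
  the maps move points, and \<open>dirac\<close> does not increase distances.\<close>

lemma approximable_dirac:
  assumes "furstenberg_family \<A>" and "\<And>i. i \<in> {1..N} \<Longrightarrow> f i \<in> Lip0"
    and "disjoint_transitive \<A> N f"
  shows "approximable \<A> N (\<lambda>i. blinfun_apply (lipfree_op (f i))) (\<lambda>i. dirac (x i))"
  unfolding approximable_def
proof (intro allI impI)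
  fix e :: real assume "e > 0"
  have "{m. ball (x 0) e \<inter> (\<Inter>i\<in>{1..N}. (f i ^^ m) -` ball (x i) e) \<noteq> {}}
    \<subseteq> {m. \<exists>v. dist v (dirac (x 0)) < e \<and>
        (\<forall>i\<in>{1..N}. dist ((blinfun_apply (lipfree_op (f i)) ^^ m) v) (dirac (x i)) < e)}"
  proof clarify
    fix m assume "ball (x 0) e \<inter> (\<Inter>i\<in>{1..N}. (f i ^^ m) -` ball (x i) e) \<noteq> {}"
    then obtain y where "y \<in> ball (x 0) e" "\<forall>i\<in>{1..N}. (f i ^^ m) y \<in> ball (x i) e"
      by blast
    then have "dist y (x 0) < e" "\<forall>i\<in>{1..N}. dist ((f i ^^ m) y) (x i) < e"
      by (simp_all add: dist_commute)
    then show "\<exists>v. dist v (dirac (x 0)) < e \<and>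
        (\<forall>i\<in>{1..N}. dist ((blinfun_apply (lipfree_op (f i)) ^^ m) v) (dirac (x i)) < e)"
      using dist_dirac_le assms(2)
      by (intro exI[of _ "dirac y"])
        (auto simp: lipfree_op_funpow_dirac intro: order.strict_trans1)
  qed
  moreover have "{m. ball (x 0) e \<inter> (\<Inter>i\<in>{1..N}. (f i ^^ m) -` ball (x i) e) \<noteq> {}} \<in> \<A>"
    using assms(3) \<open>e > 0\<close> unfolding disjoint_transitive_def
    by (elim conjE allE[of _ "\<lambda>i. ball (x i) e"]) auto
  ultimately show "{m. \<exists>v. dist v (dirac (x 0)) < e \<and>
        (\<forall>i\<in>{1..N}. dist ((blinfun_apply (lipfree_op (f i)) ^^ m) v) (dirac (x i)) < e)} \<in> \<A>"
    using assms(1) unfolding furstenberg_family_def by blast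
qed

theorem corollary5p1:
  fixes f :: "nat \<Rightarrow> 'a::{metric_space,zero} \<Rightarrow> 'a"
    and \<A> :: "nat set set"
    and N :: nat
  assumes "1 \<le> N"
    and "furstenberg_filter \<A>"
    and "\<And>i. i \<in> {1..N} \<Longrightarrow> f i \<in> Lip0"
    and "disjoint_transitive \<A> N f"
  shows "disjoint_transitive \<A> N (\<lambda>i. blinfun_apply (lipfree_op (f i)))"
proof -
  let ?T = "\<lambda>i. blinfun_apply (lipfree_op (f i))"
  have fam: "furstenberg_family \<A>" using assms(2) by (simp add: furstenberg_filter_def)
  have lin: "linear (?T i)" for i
    by (rule bounded_linear.linear[OF blinfun.bounded_linear_right])
  have single_dirac: "approximable \<A> N ?T (\<lambda>i. if i = k then dirac x else 0)" for k x
    using approximable_dirac[OF fam assms(3,4), of "\<lambda>i. if i = k then x else 0"]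
    by (simp add: if_distrib cong: if_cong)
  \<comment> \<open>Obtained by scaling an arbitrary single-entry tuple by 0; it starts both
    inductions below.\<close>
  have zero: "approximable \<A> N ?T (\<lambda>i. 0)"
    using approximable_scaleR[OF fam lin single_dirac, of 0] by simp
  have single: "approximable \<A> N ?T (\<lambda>i. if i = k then w else 0)" for k w
  proof (rule approximable_closed[OF fam])
    \<comment> \<open>The induction runs in coordinate \<open>k\<close> alone, all other entries
      staying 0; density then extends the result to every \<open>w\<close>.\<close>
    have span: "approximable \<A> N ?T (\<lambda>i. if i = k then v else 0)" if "v \<in> span (range dirac)" for v
      using that
    proof (induction rule: span_induct_alt)
      case base
      show ?case using zero by simp
    next
      case (step c x y)
      then obtain a where "x = dirac a" by auto
      then show ?case
        using approximable_add[OF assms(2) lin approximable_scaleR[OF fam lin single_dirac] step.IH, of c k a]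
        by (simp add: if_distrib if_distribR cong: if_cong)
    qed
    fix e :: real assume "e > 0"
    then obtain v where "v \<in> span (range dirac)" "dist v w < e"
      using closure_span_dirac by (metis UNIV_I closure_approachable)
    then show "\<exists>u'. approximable \<A> N ?T u' \<and> (\<forall>i\<in>{0..N}. dist (u' i) (if i = k then w else 0) < e)"
      using span \<open>e > 0\<close> by (intro exI[of _ "\<lambda>i. if i = k then v else 0"]) auto
  qed
  \<comment> \<open>A general tuple is assembled by adding one single-entry tuple at a time.\<close>
  have initial: "approximable \<A> N ?T (\<lambda>i. if i < n then u i else 0)" for n u
  proof (induction n)
    case 0
    show ?case using zero by simp
  next
    case (Suc n)
    have "(\<lambda>i. if i < Suc n then u i else 0) =
        (\<lambda>i. (if i < n then u i else 0) + (if i = n then u n else 0))"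
      by (auto simp: less_Suc_eq)
    then show ?case using approximable_add[OF assms(2) lin Suc single] by simp
  qed
  \<comment> \<open>Truncating at \<open>Suc N\<close> keeps all entries with index in
    \<open>{0..N}\<close>, so the truncated tuple is at distance 0 from \<open>u\<close> there and
    works for every \<open>e\<close>.\<close>
  have "approximable \<A> N ?T u" for u
    by (rule approximable_closed[OF fam])
      (rule exI[of _ "\<lambda>i. if i < Suc N then u i else 0"], simp add: initial)
  then show ?thesis
    by (intro disjoint_transitive_if_approximable[OF fam]) (auto intro: continuous_intros)
qed

end
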